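(* Let $\mathrm{Fm}_0$ be the set of forms and $\approx$ the congruence of commutative juxtaposition on it. The recursion $\iota(\epsilon):=\emptyset$, $\iota(\langle f\rangle):=\langle\iota(f)\rangle$, $\iota(fg):=\iota(f)\uplus\iota(g)$ induces an isomorphism of $\{\emptyset,\langle\cdot\rangle,\uplus\}$-algebras $$\iota\colon\ \mathrm{Fm}_0/{\approx}\ \xrightarrow{\ \cong\ }\ (\mathrm{HFM};\,\emptyset,\langle\cdot\rangle,\uplus),$$ which moreover carries the subform relation to the containment relation $\sqsubseteq$.
   Context: **Forms.** $\mathrm{Fm}_0$ is the smallest set of (formal) expressions containing the empty expression $\epsilon$ and closed under enclosure $f\mapsto\langle f\rangle$ and juxtaposition $(f,g)\mapsto fg$. $\approx$ is the congruence on $\mathrm{Fm}_0$ (with respect to both operations) generated by $(fg)h\approx f(gh)$, $fg\approx gf$, $f\epsilon\approx f$. The quotient is a $\{\emptyset,\langle\cdot\rangle,\uplus\}$-algebra with the class of $\epsilon$ as $\emptyset$, enclosure as $\langle\cdot\rangle$, and juxtaposition as $\uplus$. The subform relation is defined recursively: $f$ is a subform of $g$ iff $f\approx g$, or $g\approx h\langle u\rangle$ for some $h,u$ such that $f$ is a subform of $u$ (the least relation satisfying this). **Hereditarily finite multisets.** A multiset over a set $X$ is a function $X\to\mathbb{N}$ with finite support. $\mathrm{HFM}=\bigcup_n\mathcal{M}_n$, where $\mathcal{M}_0=\emptyset$ and $\mathcal{M}_{n+1}$ is the set of finite multisets over $\mathcal{M}_n$; the rank of $m$ is the least $n$ with $m\in\mathcal{M}_{n+1}$.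 $\emptyset$ is the empty multiset, $\langle x\rangle$ the singleton multiset containing $x$ once, $x\uplus y$ the multiset union (multiplicities add). Put $u\in_1 v$ iff $\exists w\,(v=w\uplus\langle u\rangle)$, and define containment by recursion on rank: $x\sqsubseteq t$ iff $x=t$ or $\exists u\,(u\in_1 t\wedge x\sqsubseteq u)$. *)

theory Defs
  imports "HOL-Library.Multiset"
begin

section \<open>Algebras with a constant, a unary and a binary operation\<close>

record 'a alg =
  carrier :: "'a set"
  emp :: 'a
  encl :: "'a \<Rightarrow> 'a"
  join :: "'a \<Rightarrow> 'a \<Rightarrow> 'a"

definition is_alg :: "'a alg \<Rightarrow> bool" where
  "is_alg A \<longleftrightarrow> emp A \<in> carrier A
     \<and> (\<forall>x\<in>carrier A. encl A x \<in> carrier A)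
     \<and> (\<forall>x\<in>carrier A. \<forall>y\<in>carrier A. join A x y \<in> carrier A)"

definition alg_iso :: "'a alg \<Rightarrow> 'b alg \<Rightarrow> ('a \<Rightarrow> 'b) \<Rightarrow> bool" where
  "alg_iso A B \<phi> \<longleftrightarrow> is_alg A \<and> is_alg B
     \<and> bij_betw \<phi> (carrier A) (carrier B)
     \<and> \<phi> (emp A) = emp B
     \<and> (\<forall>x\<in>carrier A. \<phi> (encl A x) = encl B (\<phi> x))
     \<and> (\<forall>x\<in>carrier A. \<forall>y\<in>carrier A. \<phi> (join A x y) = join B (\<phi> x) (\<phi> y))"


section \<open>Forms\<close>

text \<open>Forms are free terms: associativity and unitality of juxtaposition hold only up to
  the congruence below.\<close>

datatype form = Eps | Encl form | Juxt form form

inductive form_cong :: "form \<Rightarrow> form \<Rightarrow> bool"  (infix "\<approx>" 50) where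
  assoc: "Juxt (Juxt f g) h \<approx> Juxt f (Juxt g h)"
| comm: "Juxt f g \<approx> Juxt g f"
| unit: "Juxt f Eps \<approx> f"
| refl: "f \<approx> f"
| sym: "f \<approx> g \<Longrightarrow> g \<approx> f"
| trans: "f \<approx> g \<Longrightarrow> g \<approx> h \<Longrightarrow> f \<approx> h"
| Encl: "f \<approx> g \<Longrightarrow> Encl f \<approx> Encl g"
| Juxt: "f \<approx> f' \<Longrightarrow> g \<approx> g' \<Longrightarrow> Juxt f g \<approx> Juxt f' g'"

inductive subform :: "form \<Rightarrow> form \<Rightarrow> bool" where
  base: "f \<approx> g \<Longrightarrow> subform f g"
| step: "g \<approx> Juxt h (Encl u) \<Longrightarrow> subform f u \<Longrightarrow> subform f g"

lemma equivp_form_cong: "equivp (\<approx>)"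
  by (intro equivpI reflpI sympI transpI) (blast intro: form_cong.intros)+

quotient_type form_class = form / "(\<approx>)" morphisms rep_form_class form_class
  by (rule equivp_form_cong)

lift_definition class_Eps :: form_class is Eps .

lift_definition class_Encl :: "form_class \<Rightarrow> form_class" is Encl
  by (rule form_cong.Encl)

lift_definition class_Juxt :: "form_class \<Rightarrow> form_class \<Rightarrow> form_class" is Juxt
  by (rule form_cong.Juxt)

definition Fm_alg :: "form_class alg" where
  "Fm_alg = \<lparr>carrier = UNIV, emp = class_Eps, encl = class_Encl, join = class_Juxt\<rparr>"


section \<open>Hereditarily finite multisets\<close>

text \<open>The datatype is only an ambient universe, closed under forming finite multisets, in
  which the cumulative levels can be built; its elements are multisets of its elements.\<close>

datatype hmset = MSet (elems: "hmset multiset")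

primrec level :: "nat \<Rightarrow> hmset set" where
  "level 0 = {}"
| "level (Suc n) = MSet ` {M. set_mset M \<subseteq> level n}"

definition HFM :: "hmset set" where
  "HFM = (\<Union>n. level n)"

definition hrank :: "hmset \<Rightarrow> nat" where
  "hrank m = (LEAST n. m \<in> level (Suc n))"

definition hempty :: hmset where
  "hempty = MSet {#}"

definition hsingle :: "hmset \<Rightarrow> hmset" where
  "hsingle x = MSet {#x#}"

definition hunion :: "hmset \<Rightarrow> hmset \<Rightarrow> hmset"  (infixl "\<uplus>" 65) where
  "x \<uplus> y = MSet (elems x + elems y)"

definition HFM_alg :: "hmset alg" where
  "HFM_alg = \<lparr>carrier = HFM, emp = hempty, encl = hsingle, join = hunion\<rparr>"

definition mem1 :: "hmset \<Rightarrow> hmset \<Rightarrow> bool"  (infix "\<in>\<^sub>1" 50) where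
  "u \<in>\<^sub>1 v \<longleftrightarrow> (\<exists>w\<in>HFM. v = w \<uplus> hsingle u)"

lemma level_mono_Suc: "level n \<subseteq> level (Suc n)"
  by (induction n) auto

lemma level_mono: "m \<le> n \<Longrightarrow> level m \<subseteq> level n"
  using level_mono_Suc by (rule lift_Suc_mono_le)

lemma HFM_UNIV: "x \<in> HFM"
proof (induction x)
  case (MSet M)
  then have "\<forall>y\<in>set_mset M. \<exists>n. y \<in> level n"
    by (auto simp: HFM_def)
  then obtain k where k: "\<forall>y\<in>set_mset M. y \<in> level (k y)"
    by metis
  have "set_mset M \<subseteq> level (\<Sum>y\<in>set_mset M. k y)"
    using k level_mono by (meson finite_set_mset member_le_sum subset_iff zero_le)
  then have "MSet M \<in> level (Suc (\<Sum>y\<in>set_mset M. k y))"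
    by auto
  then show ?case
    unfolding HFM_def by blast
qed

lemma in_level_hrank: "x \<in> level (Suc (hrank x))"
proof -
  obtain n where "x \<in> level n"
    using HFM_UNIV by (auto simp: HFM_def)
  then have "x \<in> level (Suc n)"
    using level_mono_Suc by blast
  then show ?thesis
    unfolding hrank_def by (rule LeastI)
qed

lemma mem1_hrank_less:
  assumes "u \<in>\<^sub>1 v"
  shows "hrank u < hrank v"
proof -
  have "u \<in># elems v"
    using assms by (auto simp: mem1_def hunion_def hsingle_def)
  then have u: "u \<in> level (hrank v)"
    using in_level_hrank[of v] by auto
  then obtain k where k: "hrank v = Suc k"
    by (cases "hrank v") auto
  then have "hrank u \<le> k"
    using u unfolding hrank_def[of u] by (auto intro: Least_le)
  then show ?thesis
    using k by simp
qed

context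
  notes conj_cong [fundef_cong]
begin

function contained :: "hmset \<Rightarrow> hmset \<Rightarrow> bool"  (infix "\<sqsubseteq>" 50) where
  "x \<sqsubseteq> t \<longleftrightarrow> x = t \<or> (\<exists>u. u \<in>\<^sub>1 t \<and> x \<sqsubseteq> u)"
  by pat_completeness auto
termination
  by (relation "measure (\<lambda>(x, t). hrank t)") (auto simp: mem1_hrank_less)

end

declare contained.simps [simp del]


section \<open>The interpretation of forms\<close>

primrec iota :: "form \<Rightarrow> hmset" where
  "iota Eps = hempty"
| "iota (Encl f) = hsingle (iota f)"
| "iota (Juxt f g) = iota f \<uplus> iota g"

end

theory Submission
  imports Defs
begin

text \<open>The classes of forms are a commutative monoid under juxtaposition, so the finite multiset
  \<open>M\<close> can be sent to the class of the juxtaposition of the enclosures of (the forms of) its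
  elements, in any order. This map is a two-sided inverse of \<open>\<iota>\<close>. Given bijectivity, the two
  recursions defining subforms and containment correspond step by step.\<close>

instantiation form_class :: comm_monoid_add
begin

definition zero_form_class :: form_class where
  "zero_form_class = class_Eps"

definition plus_form_class :: "form_class \<Rightarrow> form_class \<Rightarrow> form_class" where
  "plus_form_class = class_Juxt"

instance
proof
  fix a b c :: form_class
  show "a + b + c = a + (b + c)"
    unfolding plus_form_class_def by transfer (rule form_cong.assoc)
  show "a + b = b + a"
    unfolding plus_form_class_def by transfer (rule form_cong.comm)
  show "0 + a = a"
    unfolding plus_form_class_def zero_form_class_def
    by transfer (blast intro: form_cong.comm form_cong.unit form_cong.trans)
qed

end

text \<open>Each generating law of \<open>\<approx>\<close> becomes a law of multiset addition, so
  \<open>iota\<close> descends to classes.\<close>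

lemma iota_cong: "f \<approx> g \<Longrightarrow> iota f = iota g"
  by (induction rule: form_cong.induct) (auto simp: hunion_def hempty_def ac_simps)

lift_definition class_iota :: "form_class \<Rightarrow> hmset" is iota
  by (rule iota_cong)

lemma class_iota_simps [simp]:
  "class_iota 0 = hempty"
  "class_iota (class_Encl x) = hsingle (class_iota x)"
  "class_iota (x + y) = class_iota x \<uplus> class_iota y"
  unfolding zero_form_class_def plus_form_class_def by (transfer, simp)+

text \<open>Recursion through the nested \<open>multiset\<close> type requires the recursive calls
  to appear under \<open>image_mset\<close>.\<close>

primrec form_class_of :: "hmset \<Rightarrow> form_class" where
  "form_class_of (MSet M) = (\<Sum>x\<in>#image_mset form_class_of M. class_Encl x)"

lemma form_class_of_simps [simp]:
  "form_class_of hempty = 0"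
  "form_class_of (hsingle x) = class_Encl (form_class_of x)"
  "form_class_of (x \<uplus> y) = form_class_of x + form_class_of y"
  by (cases x; cases y; simp add: hempty_def hsingle_def hunion_def)+

lemma form_class_of_iota: "form_class_of (iota f) = form_class f"
  by (induction f)
    (simp_all add: zero_form_class_def plus_form_class_def
      class_Eps.abs_eq class_Encl.abs_eq class_Juxt.abs_eq)

text \<open>A homomorphism turns a sum of enclosures into a union of singletons, which collects the
  values. This evaluates \<open>class_iota\<close> after \<open>form_class_of\<close>.\<close>

lemma class_iota_sum_mset:
  "class_iota (\<Sum>x\<in>#M. class_Encl (f x)) = MSet (image_mset (\<lambda>x. class_iota (f x)) M)"
  by (induction M) (simp_all add: hempty_def hsingle_def hunion_def)

lemma class_iota_form_class_of: "class_iota (form_class_of x) = x"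
proof (induction x)
  case (MSet M)
  \<comment> \<open>The induction hypothesis covers only the elements of \<open>M\<close>, which is
    all that \<open>image_mset_cong\<close> asks for.\<close>
  then have "image_mset (\<lambda>x. class_iota (form_class_of x)) M = image_mset (\<lambda>x. x) M"
    by (intro image_mset_cong)
  then show ?case
    by (simp add: class_iota_sum_mset image_mset.compositionality comp_def)
qed

lemma class_iota_form_class: "class_iota (form_class f) = iota f"
  by (simp add: class_iota.abs_eq)

text \<open>By \<open>form_class_of_iota\<close>, the value \<open>iota f\<close> determines the
  class of \<open>f\<close>.\<close>

lemma iota_eq_iff: "iota f = iota g \<longleftrightarrow> f \<approx> g"
  by (metis form_class_of_iota form_class.abs_eq_iff iota_cong)

lemma surj_iota: "surj iota"
proof (rule surjI)
  fix x
  have "class_iota c = iota (rep_form_class c)" for c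
    by (simp add: class_iota.rep_eq)
  then show "iota (rep_form_class (form_class_of x)) = x"
    by (metis class_iota_form_class_of)
qed

lemma bij_class_iota: "bij class_iota"
proof (rule bijI)
  have "form_class_of (class_iota c) = c" for c
    by (induction c rule: form_class.abs_induct)
      (simp add: class_iota_form_class form_class_of_iota)
  then show "inj class_iota"
    by (rule inj_on_inverseI)
  show "surj class_iota"
    using class_iota_form_class_of by (rule surjI)
qed

lemma contained_iota_if_subform: "subform f g \<Longrightarrow> iota f \<sqsubseteq> iota g"
proof (induction rule: subform.induct)
  case (base f g)
  then show ?case
    by (subst contained.simps) (simp add: iota_cong)
next
  case (step g h u f)
  \<comment> \<open>The witness for the rest of the multiset is \<open>iota h\<close>.\<close>
  have "iota u \<in>\<^sub>1 iota g"
    using iota_cong[OF step.hyps(1)] HFM_UNIV by (auto simp: mem1_def)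
  then show ?case
    using step.IH by (subst contained.simps) blast
qed

lemma subform_if_contained_iota: "iota f \<sqsubseteq> iota g \<Longrightarrow> subform f g"
\<comment> \<open>The induction follows the recursion of \<open>contained\<close>; \<open>g\<close>
  varies because the hypothesis is applied to a form chosen later.\<close>
proof (induction "iota f" "iota g" arbitrary: g rule: contained.induct)
  case (1 g)
  from "1.prems" consider "iota f = iota g" | u where "u \<in>\<^sub>1 iota g" "iota f \<sqsubseteq> u"
    by (subst (asm) contained.simps) blast
  then show ?case
  proof cases
    case 1
    then show ?thesis
      by (auto simp: iota_eq_iff intro: subform.base)
  next
    case (2 u)
    \<comment> \<open>Surjectivity pulls both the element and the remaining multiset back to forms,
      so that \<open>iota_eq_iff\<close> can reflect the equation as a congruence.\<close>
    obtain h u' where u: "u = iota u'" and "iota g = iota h \<uplus> hsingle u"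
      using 2(1) surj_iota unfolding mem1_def by (metis surjD)
    then have "g \<approx> Juxt h (Encl u')"
      by (simp flip: iota_eq_iff)
    moreover have "subform f u'"
      using "1.hyps" 2 u by blast
    ultimately show ?thesis
      by (rule subform.step)
  qed
qed

theorem theorem8p2:
  "\<exists>\<phi> :: form_class \<Rightarrow> hmset.
     (\<forall>f. \<phi> (form_class f) = iota f)
     \<and> alg_iso Fm_alg HFM_alg \<phi>
     \<and> (\<forall>f g. subform f g \<longleftrightarrow> \<phi> (form_class f) \<sqsubseteq> \<phi> (form_class g))"
proof (intro exI[of _ class_iota] conjI allI)
  \<comment> \<open>This turns bijectivity between the types into bijectivity between the
    carriers.\<close>
  have "HFM = UNIV"
    using HFM_UNIV by blast
  then show "alg_iso Fm_alg HFM_alg class_iota"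
    using bij_class_iota
    by (simp add: alg_iso_def is_alg_def Fm_alg_def HFM_alg_def
        flip: zero_form_class_def plus_form_class_def)
qed (auto simp: class_iota_form_class contained_iota_if_subform subform_if_contained_iota)

end
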